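(* Let $E$ be a metrizable locally convex space (in particular, a Banach space), and let $E_w$ denote $E$ endowed with the weak topology $\sigma(E,E')$. Then $E_w$ has countable fan tightness and the Reznichenko property.
   Context: $E'$ denotes the topological dual of $E$. A topological space $X$ has countable fan tightness at $x\in X$ if for all sets $A_n\subset X$, $n\in\mathbb{N}$, with $x\in\bigcap_{n\in\mathbb{N}}\overline{A_n}$ there are finite sets $F_n\subset A_n$, $n\in\mathbb{N}$, such that $x\in\overline{\bigcup_{n\in\mathbb{N}}F_n}$; $X$ has countable fan tightness if it has countable fan tightness at each point $x\in X$. A topological space $X$ has the Reznichenko property if, whenever $A\subset X$ and $x\in\overline{A}\setminus A$, there exists a countably infinite disjoint family $\mathcal{N}$ of finite subsets of $A$ such that for every neighborhood $U$ of $x$ the family $\{N\in\mathcal{N}: N\cap U=\emptyset\}$ is finite. *)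

theory Defs
  imports "HOL-Analysis.Analysis"
begin

text \<open>
  The scalar field ranges over the type classes \<open>real_normed_field\<close> and \<open>euclidean_space\<close>.
  Their only common instances, up to isometric isomorphism, are the reals and the complex
  numbers, so real and complex locally convex spaces are treated at once. The points of the
  space are all elements of the type \<open>'e\<close>; its topology is a value of type \<open>'e topology\<close>,
  because the weak topology on the same type is needed as well.
\<close>

locale topological_vector_space = vector_space scl
  for scl :: "'k::{real_normed_field,euclidean_space} \<Rightarrow> 'e::ab_group_add \<Rightarrow> 'e" +
  fixes T :: "'e topology"
  assumes topspace_UNIV: "topspace T = UNIV"
    and continuous_add: "continuous_map (prod_topology T T) T (\<lambda>(x, y). x + y)"
    and continuous_scale: "continuous_map (prod_topology euclidean T) T (\<lambda>(c, x). scl c x)"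

text \<open>The library's \<open>convex\<close> needs a \<open>real_vector\<close> instance, which \<open>'e\<close> does not carry.\<close>

definition convex_wrt ::
    "('k::{real_normed_field,euclidean_space} \<Rightarrow> 'e::ab_group_add \<Rightarrow> 'e) \<Rightarrow> 'e set \<Rightarrow> bool" where
  "convex_wrt scl C \<longleftrightarrow>
     (\<forall>x\<in>C. \<forall>y\<in>C. \<forall>u v :: real. 0 \<le> u \<longrightarrow> 0 \<le> v \<longrightarrow> u + v = 1 \<longrightarrow>
        scl (of_real u) x + scl (of_real v) y \<in> C)"

locale locally_convex_space = topological_vector_space scl T
  for scl :: "'k::{real_normed_field,euclidean_space} \<Rightarrow> 'e::ab_group_add \<Rightarrow> 'e"
    and T :: "'e topology" +
  assumes convex_base: "neighbourhood_base_at 0 (convex_wrt scl) T"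

definition topological_dual ::
    "('k::{real_normed_field,euclidean_space} \<Rightarrow> 'e::ab_group_add \<Rightarrow> 'e) \<Rightarrow> 'e topology
      \<Rightarrow> ('e \<Rightarrow> 'k) set" where
  "topological_dual scl T =
     {f. Vector_Spaces.linear scl (*) f \<and> continuous_map T euclidean f}"

definition weak_topology ::
    "('k::{real_normed_field,euclidean_space} \<Rightarrow> 'e::ab_group_add \<Rightarrow> 'e) \<Rightarrow> 'e topology
      \<Rightarrow> 'e topology" where
  "weak_topology scl T =
     topology_generated_by {f -` U |f U. f \<in> topological_dual scl T \<and> open U}"

definition countable_fan_tightness_at :: "'a topology \<Rightarrow> 'a \<Rightarrow> bool" where
  "countable_fan_tightness_at X x \<longleftrightarrow>
     (\<forall>A :: nat \<Rightarrow> 'a set.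
        (\<forall>n. A n \<subseteq> topspace X) \<longrightarrow> x \<in> (\<Inter>n. X closure_of A n) \<longrightarrow>
        (\<exists>F :: nat \<Rightarrow> 'a set. (\<forall>n. finite (F n) \<and> F n \<subseteq> A n) \<and> x \<in> X closure_of (\<Union>n. F n)))"

definition countable_fan_tightness :: "'a topology \<Rightarrow> bool" where
  "countable_fan_tightness X \<longleftrightarrow> (\<forall>x\<in>topspace X. countable_fan_tightness_at X x)"

definition Reznichenko_property :: "'a topology \<Rightarrow> bool" where
  "Reznichenko_property X \<longleftrightarrow>
     (\<forall>A x. A \<subseteq> topspace X \<longrightarrow> x \<in> X closure_of A - A \<longrightarrow>
        (\<exists>\<N>. countable \<N> \<and> infinite \<N> \<and> pairwise disjnt \<N> \<and>
             (\<forall>N\<in>\<N>. finite N \<and> N \<subseteq> A) \<and>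
             (\<forall>U. U \<subseteq> topspace X \<longrightarrow> (\<exists>V. openin X V \<and> x \<in> V \<and> V \<subseteq> U) \<longrightarrow>
                  finite {N \<in> \<N>. N \<inter> U = {}})))"

lemma topspace_weak_topology:
  assumes "vector_space scl"
  shows "topspace (weak_topology scl T) = UNIV"
proof -
  interpret vector_space scl by fact
  have "vector_space ((*) :: 'a \<Rightarrow> 'a \<Rightarrow> 'a)"
    by unfold_locales (simp_all add: algebra_simps)
  then have "Vector_Spaces.linear scl (*) (\<lambda>_. 0)"
    using assms by (simp add: Vector_Spaces.linear_iff)
  then have "(\<lambda>_. 0) \<in> topological_dual scl T"
    by (simp add: topological_dual_def)
  then have "UNIV \<in> {f -` U |f U. f \<in> topological_dual scl T \<and> open U}"
    by (intro CollectI exI[of _ "\<lambda>_. 0"] exI[of _ UNIV]) auto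
  then show ?thesis
    unfolding weak_topology_def topology_generated_by_topspace by blast
qed

lemma normed_space_locally_convex:
  "locally_convex_space (scaleR :: real \<Rightarrow> 'a \<Rightarrow> 'a::real_normed_vector) euclidean"
proof (unfold_locales, goal_cases)
  case 1
  show ?case by simp
next
  case 2
  show ?case
    by (simp add: euclidean_product_topology case_prod_unfold continuous_intros)
next
  case 3
  show ?case
    by (simp add: euclidean_product_topology case_prod_unfold continuous_intros)
next
  case 4
  show ?case
    unfolding neighbourhood_base_at_def
  proof (intro allI impI)
    fix W :: "'a set"
    assume "openin euclidean W \<and> 0 \<in> W"
    then obtain e where e: "e > 0" "ball 0 e \<subseteq> W"
      by (meson open_contains_ball open_openin)
    moreover have "convex_wrt scaleR (ball (0::'a) e)"
      using convex_ball[of "0::'a" e] by (simp add: convex_wrt_def convex_def)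
    ultimately show "\<exists>U V. openin euclidean U \<and> convex_wrt scaleR V \<and> 0 \<in> U \<and> U \<subseteq> V \<and> V \<subseteq> W"
      by (metis centre_in_ball open_ball open_openin order_refl)
  qed
qed

end

theory Submission
  imports Defs
begin

text \<open>
  Let \<open>U 0 \<supseteq> U 1 \<supseteq> \<dots>\<close> be a neighbourhood base at \<open>0\<close>. A linear functional is continuous
  if and only if it is bounded by \<open>1\<close> on some \<open>U n\<close>, so the dual is the increasing union of
  the polars of the \<open>U n\<close>, and by the Banach--Alaoglu argument every polar is compact for
  pointwise convergence (\<open>compact_polar\<close>). Metrizability of the original topology thus becomes
  \<open>\<sigma>\<close>-compactness of the dual, and it is this that controls the weak topology.

  Suppose that \<open>x\<close> is in the weak closure of \<open>A\<close>. For every \<open>n\<close>-tuple of functionals in the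
  polar of \<open>U n\<close> some \<open>a \<in> A\<close> satisfies, on all of them at once, the strict inequality that its
  value is within \<open>1 / (n + 1)\<close> of the value at \<open>x\<close>. For fixed \<open>a\<close> this is an open condition on
  the tuple, so by compactness finitely many points of \<open>A\<close> serve all tuples
  (\<open>weak_closure_imp_finite_approximation\<close>). Let \<open>F n\<close> be such a finite set for every \<open>n\<close>. A
  basic weak neighbourhood of \<open>x\<close> is given by finitely many functionals and an \<open>\<epsilon> > 0\<close>; as soon
  as \<open>n\<close> is at least their number, all of them lie in the polar of \<open>U n\<close>, and
  \<open>1 / (n + 1) < \<epsilon>\<close>, the neighbourhood meets \<open>F n\<close>
  (\<open>approximations_eventually_meet\<close>).

  Choosing \<open>F n\<close> inside the \<open>n\<close>-th given set proves countable fan tightness. For the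
  Reznichenko property one chooses \<open>F n\<close> inside \<open>A\<close> minus the earlier \<open>F m\<close>. This is possible
  because a finite set not containing \<open>x\<close> can be removed from \<open>A\<close> without \<open>x\<close> leaving the weak
  closure, provided that points are weakly closed, that is, provided that the dual separates
  points. Here local convexity enters, through the Hahn--Banach theorem
  (\<open>dual_separates_points\<close>). The latter is proved for a dominating sublinear functional by
  Zorn's lemma applied to sublinear functionals, and is carried from the reals to the scalar
  field by a nondegenerate bilinear form.
\<close>

section \<open>Sublinear functionals and the Hahn--Banach theorem\<close>

lemma vector_space_mult: "vector_space ((*) :: 'k::field \<Rightarrow> 'k \<Rightarrow> 'k)"
  by unfold_locales (simp_all add: algebra_simps)

text \<open>
  The real scalar multiplication is an explicit argument, since it will be the restriction to
  the reals of a multiplication by other scalars. Homogeneity is only required as an inequality;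
  equality follows by using it for the inverse factor as well.
\<close>

definition sublinear_wrt :: "(real \<Rightarrow> 'e::ab_group_add \<Rightarrow> 'e) \<Rightarrow> ('e \<Rightarrow> real) \<Rightarrow> bool" where
  "sublinear_wrt s q \<longleftrightarrow>
     (\<forall>x y. q (x + y) \<le> q x + q y) \<and> (\<forall>t>0. \<forall>x. q (s t x) \<le> t * q x)"

lemma sublinear_wrt_add: "sublinear_wrt s q \<Longrightarrow> q (x + y) \<le> q x + q y"
  by (simp add: sublinear_wrt_def)

lemma sublinear_wrt_scale:
  assumes "vector_space s" "sublinear_wrt s q" "t > 0"
  shows "q (s t x) = t * q x"
proof -
  interpret vector_space s by fact
  have "q (s (1/t) (s t x)) \<le> 1/t * q (s t x)"
    using assms unfolding sublinear_wrt_def by (meson divide_pos_pos zero_less_one)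
  moreover have "s (1/t) (s t x) = x"
    using assms(3) by simp
  ultimately have "t * q x \<le> q (s t x)"
    using assms(3) by (simp add: field_simps)
  then show ?thesis
    using assms(2,3) by (meson order_antisym sublinear_wrt_def)
qed

lemma sublinear_wrt_zero:
  assumes "vector_space s" "sublinear_wrt s q"
  shows "q 0 = 0"
proof -
  interpret vector_space s by fact
  have "q (s 2 0) = 2 * q 0"
    using assms by (intro sublinear_wrt_scale) auto
  then show ?thesis by simp
qed

lemma sublinear_wrt_lower_bound:
  assumes "vector_space s" "sublinear_wrt s q"
  shows "- q (- x) \<le> q x"
  using sublinear_wrt_add[OF assms(2), of x "- x"] sublinear_wrt_zero[OF assms] by simp

text \<open>
  The largest sublinear functional below \<open>q\<close> whose value at \<open>- v\<close> is at most \<open>- q v\<close>. If \<open>q\<close> is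
  already minimal, the passage to it changes nothing, and this forces additivity of \<open>q\<close>
  in the direction \<open>v\<close>.
\<close>
definition flatten_along ::
    "(real \<Rightarrow> 'e::ab_group_add \<Rightarrow> 'e) \<Rightarrow> 'e \<Rightarrow> ('e \<Rightarrow> real) \<Rightarrow> 'e \<Rightarrow> real" where
  "flatten_along s v q x = (INF t\<in>{0..}. q (x + s t v) - t * q v)"

text \<open>
  What has to be proved is that the infimum is over a set bounded below: by subadditivity
  \<open>t * q v = q (s t v) \<le> q (x + s t v) + q (- x)\<close>.
\<close>
lemma flatten_along_le:
  assumes "vector_space s" "sublinear_wrt s q" "0 \<le> t"
  shows "flatten_along s v q x \<le> q (x + s t v) - t * q v"
proof -
  interpret vector_space s by fact
  have "- q (- x) \<le> q (x + s r v) - r * q v" if "0 \<le> r" for r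
  proof -
    have "r * q v = q (s r v)"
      using that sublinear_wrt_scale[OF assms(1,2)] sublinear_wrt_zero[OF assms(1,2)]
      by (cases "r = 0") auto
    also have "\<dots> \<le> q (x + s r v) + q (- x)"
      using sublinear_wrt_add[OF assms(2), of "x + s r v" "- x"] by simp
    finally show ?thesis by simp
  qed
  then have "bdd_below ((\<lambda>t. q (x + s t v) - t * q v) ` {0..})"
    by (intro bdd_belowI2[of _ "- q (- x)"]) auto
  then show ?thesis
    unfolding flatten_along_def using assms(3) by (intro cINF_lower) auto
qed

lemma flatten_along_greatest:
  assumes "\<And>t. 0 \<le> t \<Longrightarrow> c \<le> q (x + s t v) - t * q v"
  shows "c \<le> flatten_along s v q x"
  unfolding flatten_along_def using assms by (intro cINF_greatest) auto

lemma flatten_along_le_self: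
  assumes "vector_space s" "sublinear_wrt s q"
  shows "flatten_along s v q \<le> q"
proof (rule le_funI)
  interpret vector_space s by fact
  show "flatten_along s v q x \<le> q x" for x
    using flatten_along_le[OF assms, of 0 v x] by simp
qed

text \<open>
  The parameters \<open>t\<close> for \<open>x\<close> and \<open>u\<close> for \<open>y\<close> combine to \<open>t + u\<close> for \<open>x + y\<close>, and the parameter
  \<open>t\<close> for \<open>x\<close> becomes \<open>c * t\<close> for the multiple of \<open>x\<close> by \<open>c\<close>.
\<close>
lemma sublinear_wrt_flatten_along:
  assumes "vector_space s" "sublinear_wrt s q"
  shows "sublinear_wrt s (flatten_along s v q)"
proof -
  interpret vector_space s by fact
  let ?r = "flatten_along s v q"
  have "?r (x + y) \<le> ?r x + ?r y" for x y
  proof -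
    have *: "?r (x + y) \<le> (q (x + s t v) - t * q v) + (q (y + s u v) - u * q v)"
      if "0 \<le> t" "0 \<le> u" for t u
    proof -
      have "?r (x + y) \<le> q ((x + y) + s (t + u) v) - (t + u) * q v"
        using that by (intro flatten_along_le[OF assms]) auto
      also have "(x + y) + s (t + u) v = (x + s t v) + (y + s u v)"
        by (simp add: scale_left_distrib algebra_simps)
      also have "q \<dots> \<le> q (x + s t v) + q (y + s u v)"
        by (rule sublinear_wrt_add[OF assms(2)])
      finally show ?thesis by (simp add: algebra_simps)
    qed
    have "?r (x + y) - (q (x + s t v) - t * q v) \<le> ?r y" if "0 \<le> t" for t
      using *[OF that] by (intro flatten_along_greatest) (simp add: algebra_simps)
    then have "?r (x + y) - ?r y \<le> ?r x"
      by (intro flatten_along_greatest) (simp add: algebra_simps)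
    then show ?thesis by simp
  qed
  moreover have "?r (s c x) \<le> c * ?r x" if "c > 0" for c x
  proof -
    have "?r (s c x) / c \<le> q (x + s t v) - t * q v" if "0 \<le> t" for t
    proof -
      have "?r (s c x) \<le> q (s c x + s (c * t) v) - (c * t) * q v"
        using that \<open>c > 0\<close> by (intro flatten_along_le[OF assms]) auto
      also have "s c x + s (c * t) v = s c (x + s t v)"
        by (simp add: scale_right_distrib)
      also have "q \<dots> = c * q (x + s t v)"
        by (rule sublinear_wrt_scale[OF assms \<open>c > 0\<close>])
      finally show ?thesis
        using \<open>c > 0\<close> by (simp add: field_simps)
    qed
    then have "?r (s c x) / c \<le> ?r x"
      by (rule flatten_along_greatest)
    then show ?thesis
      using that by (simp add: field_simps)
  qed
  ultimately show ?thesis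
    by (simp add: sublinear_wrt_def)
qed

text \<open>
  The pointwise infimum of a chain is again sublinear, and it is finite because every
  member \<open>q\<close> satisfies \<open>- p (- x) \<le> - q (- x) \<le> q x\<close>; so Zorn's lemma applies downwards.
\<close>
lemma ex_minimal_sublinear:
  assumes "vector_space s" "sublinear_wrt s p"
  obtains m where "sublinear_wrt s m" "m \<le> p"
    "\<And>q. sublinear_wrt s q \<Longrightarrow> q \<le> m \<Longrightarrow> q = m"
proof -
  interpret vector_space s by fact
  define Q where "Q = {q. sublinear_wrt s q \<and> q \<le> p}"
  let ?R = "relation_of (\<lambda>a b. b \<le> a) Q"
  have "\<exists>m\<in>Q. \<forall>a\<in>Q. a \<le> m \<longrightarrow> a = m"
  proof (rule predicate_Zorn)
    show "partial_order_on Q ?R"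
      by (rule partial_order_on_relation_ofI) auto
  next
    fix C assume C: "C \<in> Chains ?R"
    show "\<exists>u\<in>Q. \<forall>a\<in>C. u \<le> a"
    proof (cases "C = {}")
      case True
      then show ?thesis using assms(2) by (auto simp: Q_def)
    next
      case False
      have CQ: "C \<subseteq> Q"
        using C by (auto simp: Chains_def relation_of_def)
      have tot: "a \<le> b \<or> b \<le> a" if "a \<in> C" "b \<in> C" for a b
        using C that by (auto simp: Chains_def relation_of_def)
      define u where "u x = (INF q\<in>C. q x)" for x
      have low: "u x \<le> q x" if "q \<in> C" for q x
      proof -
        have "- p (- x) \<le> r x" if "r \<in> C" for r
        proof -
          have "r (- x) \<le> p (- x)" "- r (- x) \<le> r x"
            using that CQ sublinear_wrt_lower_bound[OF assms(1)] by (auto simp: Q_def le_fun_def)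
          then show ?thesis by linarith
        qed
        then have "bdd_below ((\<lambda>q. q x) ` C)"
          by (rule bdd_belowI2)
        then show ?thesis
          unfolding u_def using that by (rule cINF_lower)
      qed
      have great: "c \<le> u x" if "\<And>q. q \<in> C \<Longrightarrow> c \<le> q x" for c x
        unfolding u_def using that False by (intro cINF_greatest)
      \<comment> \<open>Different members may be used for \<open>x\<close> and \<open>y\<close>, because the smaller of the two serves both.\<close>
      have sub: "u (x + y) \<le> q x + r y" if "q \<in> C" "r \<in> C" for x y q r
      proof -
        have "\<exists>w\<in>C. w \<le> q \<and> w \<le> r"
          using tot[OF that] that by auto
        then obtain w where w: "w \<in> C" "w \<le> q" "w \<le> r" by blast
        have "u (x + y) \<le> w (x + y)" by (rule low[OF w(1)])
        also have "\<dots> \<le> w x + w y"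
          using w(1) CQ by (auto simp: Q_def sublinear_wrt_def)
        also have "\<dots> \<le> q x + r y"
          using w(2,3) by (intro add_mono) (auto simp: le_fun_def)
        finally show ?thesis .
      qed
      have "u (x + y) - q x \<le> u y" if "q \<in> C" for x y q
        using sub[OF that, of _ x y] by (intro great) (simp add: algebra_simps)
      then have "u (x + y) - u y \<le> u x" for x y
        by (intro great) (simp add: algebra_simps)
      then have "u (x + y) \<le> u x + u y" for x y
        by (simp add: algebra_simps)
      moreover have "u (s t x) \<le> t * u x" if "t > 0" for t x
      proof -
        have "u (s t x) / t \<le> q x" if "q \<in> C" for q
        proof -
          have "u (s t x) \<le> q (s t x)" by (rule low[OF that])
          also have "\<dots> = t * q x"
            using that CQ \<open>t > 0\<close> by (intro sublinear_wrt_scale[OF assms(1)]) (auto simp: Q_def)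
          finally show ?thesis using \<open>t > 0\<close> by (simp add: field_simps)
        qed
        then have "u (s t x) / t \<le> u x" by (rule great)
        then show ?thesis using that by (simp add: field_simps)
      qed
      ultimately have "sublinear_wrt s u"
        by (simp add: sublinear_wrt_def)
      moreover obtain q where "q \<in> C" using False by blast
      then have "u \<le> p"
        using low CQ unfolding Q_def le_fun_def by (blast intro: order_trans)
      ultimately show ?thesis
        using low by (auto simp: Q_def le_fun_def)
    qed
  qed
  then obtain m where m: "m \<in> Q" "\<And>a. a \<in> Q \<Longrightarrow> a \<le> m \<Longrightarrow> a = m" by blast
  show ?thesis
  proof (rule that[of m])
    show "sublinear_wrt s m" "m \<le> p"
      using m(1) by (auto simp: Q_def)
    show "q = m" if "sublinear_wrt s q" "q \<le> m" for q
      using that m by (auto simp: Q_def intro: order_trans)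
  qed
qed

text \<open>
  Minimality says that flattening \<open>m\<close> along \<open>y\<close> gives \<open>m\<close> back; the parameter \<open>1\<close> in the
  infimum then reads \<open>m x \<le> m (x + y) - m y\<close>, the reverse of subadditivity.
\<close>
lemma minimal_sublinear_imp_linear:
  assumes "vector_space s" and m: "sublinear_wrt s m"
    and min: "\<And>q. sublinear_wrt s q \<Longrightarrow> q \<le> m \<Longrightarrow> q = m"
  shows "Vector_Spaces.linear s (*) m"
proof -
  interpret vector_space s by fact
  have add: "m (x + y) = m x + m y" for x y
  proof (rule order_antisym)
    have "flatten_along s y m = m"
      using assms(1) m by (intro min sublinear_wrt_flatten_along flatten_along_le_self)
    then have "m x \<le> m (x + s 1 y) - 1 * m y"
      using flatten_along_le[OF assms(1) m, of 1 y x] by simp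
    then show "m x + m y \<le> m (x + y)" by simp
    show "m (x + y) \<le> m x + m y" by (rule sublinear_wrt_add[OF m])
  qed
  have zero: "m 0 = 0"
    using assms(1) m by (rule sublinear_wrt_zero)
  have neg: "m (- x) = - m x" for x
    using add[of x "- x"] zero by simp
  have "m (s t x) = t * m x" for t x
  proof (cases t "0 :: real" rule: linorder_cases)
    case less
    then have "m (s (- t) x) = - t * m x"
      by (intro sublinear_wrt_scale[OF assms(1) m]) auto
    then show ?thesis by (simp add: neg)
  next
    case equal
    then show ?thesis by (simp add: zero)
  next
    case greater
    then show ?thesis by (rule sublinear_wrt_scale[OF assms(1) m])
  qed
  then show ?thesis
    using assms(1) add by (simp add: Vector_Spaces.linear_iff vector_space_mult)
qed

text \<open>
  A minimal sublinear functional is sought below the flattening of \<open>p\<close> along \<open>v\<close> rather than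
  below \<open>p\<close>: its value at \<open>- v\<close> is then at most \<open>- p v\<close>, which by linearity gives
  the lower bound \<open>p v\<close> at \<open>v\<close>.
\<close>
theorem Hahn_Banach_dominated:
  assumes "vector_space s" "sublinear_wrt s p"
  obtains \<phi> where "Vector_Spaces.linear s (*) \<phi>" "\<phi> \<le> p" "\<phi> v = p v"
proof -
  interpret vector_space s by fact
  obtain m where m: "sublinear_wrt s m" "m \<le> flatten_along s v p"
    and min: "\<And>q. sublinear_wrt s q \<Longrightarrow> q \<le> m \<Longrightarrow> q = m"
    using ex_minimal_sublinear[OF assms(1) sublinear_wrt_flatten_along[OF assms, of v]] by metis
  have lin: "Vector_Spaces.linear s (*) m"
    using assms(1) m(1) min by (rule minimal_sublinear_imp_linear)
  then interpret m: Vector_Spaces.linear s "(*)" m .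
  have mp: "m \<le> p"
    using m(2) flatten_along_le_self[OF assms, of v] by (rule order_trans)
  have "m (- v) \<le> flatten_along s v p (- v)"
    using m(2) by (simp add: le_fun_def)
  also have "\<dots> \<le> p (- v + s 1 v) - 1 * p v"
    by (rule flatten_along_le[OF assms]) simp
  also have "\<dots> = - p v"
    using sublinear_wrt_zero[OF assms] by simp
  finally have "p v \<le> m v" by (simp add: m.neg)
  moreover have "m v \<le> p v" using mp by (simp add: le_fun_def)
  ultimately show ?thesis using that lin mp by force
qed

section \<open>From real functionals to functionals over the scalar field\<close>

text \<open>
  The real bilinear form \<open>(d, c) \<mapsto> 1 \<bullet> (d * c)\<close> on the scalar field plays the part that the real
  part of \<open>d * c\<close> plays for complex scalars; arguing with it treats both fields at once.
\<close>
lemma inner_one_mult_nondegenerate: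
  fixes d :: "'k::{real_normed_field,euclidean_space}"
  assumes "\<And>c. 1 \<bullet> (d * c) = 0"
  shows "d = 0"
proof (rule ccontr)
  assume "d \<noteq> 0"
  then have "(1::'k) \<bullet> 1 = 0" using assms[of "inverse d"] by simp
  then show False by simp
qed

text \<open>
  As the form \<open>1 \<bullet> (d * c)\<close> is nondegenerate and the scalars are finite-dimensional over the
  reals, every real functional \<open>h\<close> on the scalars is \<open>c \<mapsto> 1 \<bullet> (d * c)\<close> for some \<open>d\<close>. The map
  \<open>D\<close> finds \<open>d\<close> from the coordinates of \<open>h\<close>; that it is linear makes \<open>d\<close> depend boundedly on
  them.
\<close>
lemma scalar_functional_representation:
  "\<exists>D :: 'k::{real_normed_field,euclidean_space} \<Rightarrow> 'k.
     linear D \<and> (\<forall>h c. linear h \<longrightarrow> 1 \<bullet> (D (\<Sum>b\<in>Basis. h b *\<^sub>R b) * c) = h c)"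
proof -
  define M :: "'k \<Rightarrow> 'k" where "M d = (\<Sum>b\<in>Basis. (1 \<bullet> (d * b)) *\<^sub>R b)" for d
  have lin: "linear M"
    unfolding M_def
    by (intro linearI)
      (simp_all add: algebra_simps inner_add_right sum.distrib scaleR_sum_right)
  have Mb: "M d \<bullet> b = 1 \<bullet> (d * b)" if "b \<in> Basis" for d b :: 'k
    using that by (simp add: M_def)
  have eqI: "1 \<bullet> (d * c) = h c" if "\<And>b. b \<in> Basis \<Longrightarrow> 1 \<bullet> (d * b) = h b" "linear h"
    for d c :: 'k and h
  proof -
    have "linear (\<lambda>c. 1 \<bullet> (d * c))"
      by (intro linearI) (simp_all add: algebra_simps inner_add_right)
    then have "(\<lambda>c. 1 \<bullet> (d * c)) = h"
      using that by (intro linear_eq_stdbasis)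
    then show ?thesis by metis
  qed
  have "inj M"
  proof (subst linear_injective_0[OF lin], intro allI impI)
    fix d assume "M d = 0"
    then have "1 \<bullet> (d * b) = (\<lambda>_. 0) b" if "b \<in> Basis" for b
      using Mb[OF that, of d] by simp
    moreover have "linear (\<lambda>_::'k. 0::real)" by (intro linearI) auto
    ultimately have "1 \<bullet> (d * c) = 0" for c
      using eqI[of d "\<lambda>_. 0" c] by blast
    then show "d = 0" by (rule inner_one_mult_nondegenerate)
  qed
  then obtain D where D: "linear D" "\<And>x. M (D x) = x"
    using linear_injective_isomorphism[OF lin] by metis
  show ?thesis
  proof (intro exI[of _ D] conjI allI impI D(1))
    fix h :: "'k \<Rightarrow> real" and c assume h: "linear h"
    let ?d = "D (\<Sum>b\<in>Basis. h b *\<^sub>R b)"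
    have "1 \<bullet> (?d * b) = h b" if "b \<in> Basis" for b
      using Mb[OF that, of ?d] that by (simp add: D(2))
    then show "1 \<bullet> (?d * c) = h c"
      using h by (rule eqI)
  qed
qed

text \<open>
  The value \<open>f x\<close> is the scalar that represents the real functional \<open>c \<mapsto> \<phi> (scl c x)\<close>. Linearity
  over the scalars holds because this representation is unique. For complex scalars this is the
  classical \<open>f x = \<phi> x - \<i> \<phi> (\<i> x)\<close>. The estimate is what yields continuity of \<open>f\<close>.
\<close>
lemma real_functional_lift_to_scalars:
  fixes scl :: "'k::{real_normed_field,euclidean_space} \<Rightarrow> 'e::ab_group_add \<Rightarrow> 'e"
  assumes "vector_space scl" "Vector_Spaces.linear (\<lambda>t. scl (of_real t)) (*) \<phi>"
  obtains f K where "Vector_Spaces.linear scl (*) f" "\<And>x. 1 \<bullet> f x = \<phi> x" "K > 0"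
    "\<And>x. norm (f x) \<le> K * (\<Sum>b\<in>Basis. \<bar>\<phi> (scl b x)\<bar>)"
proof -
  interpret vector_space scl by fact
  obtain D :: "'k \<Rightarrow> 'k" where D':
    "linear D \<and> (\<forall>h c. linear h \<longrightarrow> 1 \<bullet> (D (\<Sum>b\<in>Basis. h b *\<^sub>R b) * c) = h c)"
    using scalar_functional_representation by (rule exE)
  note D = conjunct1[OF D'] conjunct2[OF D', rule_format]
  have \<phi>: "\<phi> (x + y) = \<phi> x + \<phi> y" "\<phi> (scl (of_real t) x) = t * \<phi> x" for x y t
    using assms(2) by (simp_all add: Vector_Spaces.linear_iff)
  define f where "f x = D (\<Sum>b\<in>Basis. \<phi> (scl b x) *\<^sub>R b)" for x
  have f: "1 \<bullet> (f x * c) = \<phi> (scl c x)" for x c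
    unfolding f_def
  proof (rule D(2), rule linearI)
    show "\<phi> (scl (a + b) x) = \<phi> (scl a x) + \<phi> (scl b x)" for a b
      by (simp add: scale_left_distrib \<phi>(1))
    have "scl (r *\<^sub>R a) x = scl (of_real r) (scl a x)" for r a
      by (simp add: scaleR_conv_of_real)
    then show "\<phi> (scl (r *\<^sub>R a) x) = r *\<^sub>R \<phi> (scl a x)" for r a
      by (simp only: \<phi>(2) real_scaleR_def)
  qed
  have "f (x + y) - (f x + f y) = 0" for x y
  proof (rule inner_one_mult_nondegenerate)
    fix c
    have "(f (x + y) - (f x + f y)) * c = f (x + y) * c - (f x * c + f y * c)"
      by (simp add: left_diff_distrib distrib_right)
    then show "1 \<bullet> ((f (x + y) - (f x + f y)) * c) = 0"
      by (simp add: inner_diff_right inner_add_right f scale_right_distrib \<phi>(1))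
  qed
  moreover have "f (scl e x) - e * f x = 0" for e x
  proof (rule inner_one_mult_nondegenerate)
    fix c
    have "(f (scl e x) - e * f x) * c = f (scl e x) * c - f x * (c * e)"
      by (simp add: algebra_simps)
    then show "1 \<bullet> ((f (scl e x) - e * f x) * c) = 0"
      by (simp add: inner_diff_right f)
  qed
  ultimately have lin: "Vector_Spaces.linear scl (*) f"
    using assms(1) by (simp add: Vector_Spaces.linear_iff vector_space_mult)
  obtain K where K: "K > 0" "\<And>z. norm (D z) \<le> K * norm z"
    using linear_bounded_pos[OF D(1)] by blast
  have "norm (f x) \<le> K * (\<Sum>b\<in>Basis. \<bar>\<phi> (scl b x)\<bar>)" for x
  proof -
    have "norm (\<Sum>b\<in>Basis. \<phi> (scl b x) *\<^sub>R b) \<le> (\<Sum>b\<in>Basis. \<bar>\<phi> (scl b x)\<bar>)"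
      by (rule order_trans[OF norm_sum]) simp
    then have "K * norm (\<Sum>b\<in>Basis. \<phi> (scl b x) *\<^sub>R b) \<le> K * (\<Sum>b\<in>Basis. \<bar>\<phi> (scl b x)\<bar>)"
      using K(1) by (intro mult_left_mono) auto
    with K(2) show ?thesis
      unfolding f_def by (rule order_trans)
  qed
  moreover have "1 \<bullet> f x = \<phi> x" for x
    using f[of x 1] by simp
  ultimately show ?thesis
    using that[OF lin _ K(1)] by simp
qed

section \<open>Continuous functionals on locally convex spaces\<close>

context topological_vector_space
begin

lemma continuous_map_translate: "continuous_map T T (\<lambda>y. y - x)"
proof -
  have "continuous_map T T ((\<lambda>(a, b). a + b) \<circ> (\<lambda>y. (y, - x)))"
    by (rule continuous_map_compose[OF _ continuous_add])
      (simp add: continuous_map_pairwise o_def topspace_UNIV)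
  then show ?thesis by (simp add: o_def)
qed

lemma continuous_map_scale_vector: "continuous_map T T (scl c)"
proof -
  have "continuous_map T T ((\<lambda>(a, b). scl a b) \<circ> (\<lambda>y. (c, y)))"
    by (rule continuous_map_compose[OF _ continuous_scale])
      (simp add: continuous_map_pairwise o_def)
  then show ?thesis by (simp add: o_def)
qed

lemma continuous_map_scale_scalar: "continuous_map euclidean T (\<lambda>c. scl c x)"
proof -
  have "continuous_map euclidean T ((\<lambda>(a, b). scl a b) \<circ> (\<lambda>c. (c, x)))"
    by (rule continuous_map_compose[OF _ continuous_scale])
      (simp add: continuous_map_pairwise o_def topspace_UNIV)
  then show ?thesis by (simp add: o_def)
qed

lemma neighbourhood_absorbs:
  assumes "openin T U" "0 \<in> U"
  obtains t :: real where "t > 0" "scl (of_real (1/t)) x \<in> U"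
proof -
  have "open {c. scl c x \<in> U}"
    using openin_continuous_map_preimage[OF continuous_map_scale_scalar assms(1)] by simp
  moreover have "0 \<in> {c. scl c x \<in> U}"
    using assms(2) by simp
  ultimately obtain e where e: "e > 0" "ball 0 e \<subseteq> {c. scl c x \<in> U}"
    by (meson open_contains_ball)
  \<comment> \<open>Any \<open>t > 1/e\<close> would do.\<close>
  have "of_real (1 / (2/e)) \<in> ball (0::'k) e"
    using e(1) by (simp add: norm_divide)
  then have "scl (of_real (1 / (2/e))) x \<in> U"
    using e(2) by blast
  then show ?thesis using e(1) by (intro that[of "2/e"]) auto
qed

lemma bounded_on_neighbourhood_imp_dual:
  assumes f: "Vector_Spaces.linear scl (*) f"
    and U: "openin T U" "0 \<in> U" and bd: "\<And>y. y \<in> U \<Longrightarrow> norm (f y) \<le> B"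
  shows "f \<in> topological_dual scl T"
proof -
  interpret f: Vector_Spaces.linear scl "(*)" f by fact
  have "0 \<le> B"
    using bd[OF U(2)] by (meson norm_ge_zero order_trans)
  have "openin T {y. f y \<in> V}" if "open V" for V
  proof (subst openin_subopen, intro ballI)
    fix x assume "x \<in> {y. f y \<in> V}"
    then obtain e where e: "e > 0" "ball (f x) e \<subseteq> V"
      using \<open>open V\<close> by (auto simp: open_contains_ball)
    \<comment> \<open>Adding \<open>1\<close> keeps the denominator positive if \<open>B = 0\<close> and makes \<open>c * B < e\<close> strict.\<close>
    define c where "c = e / (B + 1)"
    have c: "c > 0" "c * B < e"
      using e(1) \<open>0 \<le> B\<close> by (auto simp: c_def field_simps)
    let ?W = "{y. scl (of_real (1/c)) (y - x) \<in> U}"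
    have "continuous_map T T (\<lambda>y. scl (of_real (1/c)) (y - x))"
      using continuous_map_compose[OF continuous_map_translate continuous_map_scale_vector]
      by (simp add: o_def)
    then have "openin T ?W"
      using openin_continuous_map_preimage[of T T "\<lambda>y. scl (of_real (1/c)) (y - x)" U] U(1)
      by (simp add: topspace_UNIV del: of_real_divide)
    moreover have "x \<in> ?W" using U(2) by simp
    moreover have "?W \<subseteq> {y. f y \<in> V}"
    proof (intro subsetI CollectI)
      fix y assume "y \<in> ?W"
      then have "norm (f (scl (of_real (1/c)) (y - x))) \<le> B"
        using bd by blast
      then have "norm (f y - f x) / c \<le> B"
        using c(1) by (simp add: f.scale f.diff norm_mult norm_divide)
      then have "norm (f y - f x) < e"
        using c by (simp add: field_simps)
      then show "f y \<in> V"
        using e(2) by (auto simp: dist_norm norm_minus_commute)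
    qed
    ultimately show "\<exists>W. openin T W \<and> x \<in> W \<and> W \<subseteq> {y. f y \<in> V}"
      by (intro exI[of _ ?W] conjI)
  qed
  then show ?thesis
    using f by (simp add: topological_dual_def continuous_map_def topspace_UNIV)
qed

text \<open>
  The functional is the Minkowski gauge of \<open>C\<close>: finite because the neighbourhood \<open>U\<close> absorbs
  every vector, subadditive because \<open>C\<close> is convex. If it were less than \<open>1\<close> at \<open>v\<close>, then \<open>v\<close> would
  be a convex combination of \<open>0\<close> and a point of \<open>C\<close>.
\<close>
lemma gauge_of_convex_neighbourhood:
  assumes C: "convex_wrt scl C" and U: "openin T U" "0 \<in> U" "U \<subseteq> C" and v: "v \<notin> C"
  obtains p where "sublinear_wrt (\<lambda>t. scl (of_real t)) p" "\<And>x. x \<in> C \<Longrightarrow> p x \<le> 1" "p v \<ge> 1"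
proof -
  define R where "R x = {t. 0 < t \<and> scl (of_real (1/t)) x \<in> C}" for x
  have R_ne: "R x \<noteq> {}" for x
    using neighbourhood_absorbs[OF U(1,2), of x] U(3) by (auto simp: R_def)
  have R_bdd: "bdd_below (R x)" for x
    by (rule bdd_belowI[of _ 0]) (auto simp: R_def)
  have le: "Inf (R x) \<le> t" if "t \<in> R x" for x t
    using that R_bdd by (rule cInf_lower)
  have great: "c \<le> Inf (R x)" if "\<And>t. t \<in> R x \<Longrightarrow> c \<le> t" for c x
    using R_ne that by (rule cInf_greatest)
  have add: "t + u \<in> R (x + y)" if "t \<in> R x" "u \<in> R y" for t u x y
  proof -
    have tu: "0 < t" "0 < u" "scl (of_real (1/t)) x \<in> C" "scl (of_real (1/u)) y \<in> C"
      using that by (auto simp: R_def)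
    have "t / (t + u) + u / (t + u) = 1"
      using tu by (simp flip: add_divide_distrib)
    then have "scl (of_real (t / (t + u))) (scl (of_real (1/t)) x)
        + scl (of_real (u / (t + u))) (scl (of_real (1/u)) y) \<in> C"
      using tu by (intro C[unfolded convex_wrt_def, rule_format]) auto
    moreover have "t / (t + u) * (1/t) = 1 / (t + u)" "u / (t + u) * (1/u) = 1 / (t + u)"
      using tu by auto
    ultimately have "scl (of_real (1 / (t + u))) x + scl (of_real (1 / (t + u))) y \<in> C"
      by (simp only: scale_scale flip: of_real_mult)
    then show ?thesis
      using tu by (simp add: R_def scale_right_distrib)
  qed
  have "sublinear_wrt (\<lambda>t. scl (of_real t)) (\<lambda>x. Inf (R x))"
    unfolding sublinear_wrt_def
  proof (intro conjI allI impI)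
    fix x y
    have "Inf (R (x + y)) - t \<le> Inf (R y)" if "t \<in> R x" for t
      using le[OF add[OF that, of _ y]] by (intro great) (simp only: diff_le_eq add.commute)
    then have "Inf (R (x + y)) - Inf (R y) \<le> Inf (R x)"
      by (intro great) (simp add: algebra_simps)
    then show "Inf (R (x + y)) \<le> Inf (R x) + Inf (R y)" by simp
  next
    fix c :: real and x assume c: "0 < c"
    have "Inf (R (scl (of_real c) x)) / c \<le> t" if "t \<in> R x" for t
    proof -
      have "1 / (c * t) * c = 1 / t" using c by simp
      then have rescale: "scl (of_real (1 / (c * t))) (scl (of_real c) x) = scl (of_real (1/t)) x"
        by (simp only: scale_scale flip: of_real_mult)
      have "c * t \<in> R (scl (of_real c) x)"
        using that c by (simp only: R_def mem_Collect_eq rescale) simp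
      then have "Inf (R (scl (of_real c) x)) \<le> c * t" by (rule le)
      then show ?thesis
        using c by (simp add: field_simps)
    qed
    then have "Inf (R (scl (of_real c) x)) / c \<le> Inf (R x)"
      by (rule great)
    then show "Inf (R (scl (of_real c) x)) \<le> c * Inf (R x)"
      using c by (simp add: field_simps)
  qed
  moreover have "Inf (R x) \<le> 1" if "x \<in> C" for x
    using that by (intro le) (simp add: R_def)
  moreover have "1 \<le> Inf (R v)"
  proof (rule great, rule ccontr)
    fix t assume t: "t \<in> R v" "\<not> 1 \<le> t"
    have "0 \<in> C" "0 < t" "scl (of_real (1/t)) v \<in> C"
      using U t by (auto simp: R_def)
    moreover have "0 \<le> t" "0 \<le> 1 - t" "t + (1 - t) = 1"
      using t \<open>0 < t\<close> by auto
    ultimately have "scl (of_real t) (scl (of_real (1/t)) v) + scl (of_real (1 - t)) 0 \<in> C"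
      by (intro C[unfolded convex_wrt_def, rule_format])
    moreover have "t * (1/t) = 1"
      using \<open>0 < t\<close> by simp
    ultimately have "scl (of_real 1) v + scl (of_real (1 - t)) 0 \<in> C"
      by (simp only: scale_scale flip: of_real_mult)
    then show False
      using v by simp
  qed
  ultimately show ?thesis by (rule that)
qed

end

text \<open>
  A convex neighbourhood of \<open>0\<close> that misses \<open>v = x - y\<close> has a gauge \<open>p\<close> with \<open>p v \<ge> 1\<close>, and
  Hahn--Banach gives a real functional \<open>\<phi> \<le> p\<close> with \<open>\<phi> v = p v\<close>. Its lift to the scalar field
  is bounded where all multiples of a vector by plus or minus a basis scalar lie in that
  neighbourhood.
\<close>
lemma (in locally_convex_space) dual_separates_points:
  assumes "Hausdorff_space T" "x \<noteq> y"
  obtains f where "f \<in> topological_dual scl T" "f x \<noteq> f y"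
proof -
  define v where "v = x - y"
  have "v \<noteq> 0" using assms(2) by (simp add: v_def)
  then obtain W where W: "openin T W" "0 \<in> W" "v \<notin> W"
    using Hausdorff_imp_t1_space[OF assms(1)] unfolding t1_space_def topspace_UNIV
    by (metis UNIV_I)
  then obtain U C where UC: "openin T U" "convex_wrt scl C" "0 \<in> U" "U \<subseteq> C" "C \<subseteq> W"
    using convex_base unfolding neighbourhood_base_at_def by meson
  let ?s = "\<lambda>t::real. scl (of_real t)"
  have "v \<notin> C" using UC W by blast
  then obtain p where p: "sublinear_wrt ?s p" "\<And>x. x \<in> C \<Longrightarrow> p x \<le> 1" "p v \<ge> 1"
    using gauge_of_convex_neighbourhood[OF UC(2,1,3,4)] by metis
  have vs: "vector_space ?s"
    by unfold_locales (simp_all add: scale_left_distrib scale_right_distrib)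
  obtain \<phi> where \<phi>: "Vector_Spaces.linear ?s (*) \<phi>" "\<phi> \<le> p" "\<phi> v = p v"
    using Hahn_Banach_dominated[OF vs p(1)] by metis
  have \<phi>_neg: "\<phi> (- z) = - \<phi> z" for z
  proof -
    interpret \<phi>: Vector_Spaces.linear ?s "(*)" \<phi> by (rule \<phi>(1))
    show ?thesis by (rule \<phi>.neg)
  qed
  obtain f K where f: "Vector_Spaces.linear scl (*) f" "\<And>x. 1 \<bullet> f x = \<phi> x" "K > 0"
    "\<And>x. norm (f x) \<le> K * (\<Sum>b\<in>Basis. \<bar>\<phi> (scl b x)\<bar>)"
    using real_functional_lift_to_scalars[OF vector_space_axioms \<phi>(1)] by metis
  define N where "N = (\<Inter>b\<in>Basis. {x. scl b x \<in> U} \<inter> {x. scl (- b) x \<in> U})"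
  have "openin T {x. scl c x \<in> U}" for c
    using openin_continuous_map_preimage[OF continuous_map_scale_vector UC(1)]
    by (simp add: topspace_UNIV)
  then have "openin T N"
    unfolding N_def using finite_Basis nonempty_Basis by (intro openin_INT2 openin_Int)
  moreover have "0 \<in> N"
    using UC(3) by (simp add: N_def)
  moreover have "norm (f z) \<le> K * DIM('k)" if "z \<in> N" for z
  proof -
    have "\<bar>\<phi> (scl b z)\<bar> \<le> 1" if b: "b \<in> Basis" for b
    proof -
      have "scl b z \<in> C" "- scl b z \<in> C"
        using \<open>z \<in> N\<close> b UC(4) by (auto simp: N_def)
      then have "p (scl b z) \<le> 1" "p (- scl b z) \<le> 1"
        using p(2) by auto
      moreover have "\<phi> (scl b z) \<le> p (scl b z)" "\<phi> (- scl b z) \<le> p (- scl b z)"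
        using \<phi>(2) by (auto simp: le_fun_def)
      ultimately show ?thesis by (simp add: \<phi>_neg)
    qed
    then have "(\<Sum>b\<in>(Basis::'k set). \<bar>\<phi> (scl b z)\<bar>) \<le> DIM('k)"
      using sum_bounded_above[of "Basis::'k set" "\<lambda>b. \<bar>\<phi> (scl b z)\<bar>" 1] by simp
    then have "K * (\<Sum>b\<in>(Basis::'k set). \<bar>\<phi> (scl b z)\<bar>) \<le> K * DIM('k)"
      using f(3) by (intro mult_left_mono) auto
    with f(4)[of z] show ?thesis by (rule order_trans)
  qed
  ultimately have "f \<in> topological_dual scl T"
    using bounded_on_neighbourhood_imp_dual[OF f(1)] by blast
  moreover have "f v \<noteq> 0"
  proof
    assume "f v = 0"
    then have "\<phi> v = 0" using f(2)[of v] by simp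
    then show False using \<phi>(3) p(3) by linarith
  qed
  then have "f x \<noteq> f y"
    using module_hom.diff[OF Vector_Spaces.linear.axioms(3)[OF f(1)], of x y] by (simp add: v_def)
  ultimately show ?thesis
    by (rule that)
qed

section \<open>The weak topology\<close>

lemma openin_weak_topology_preimage:
  assumes "f \<in> topological_dual scl T" "open U"
  shows "openin (weak_topology scl T) (f -` U)"
  unfolding weak_topology_def using assms by (intro topology_generated_by_Basis) auto

lemma openin_weak_topology_imp_functionals:
  assumes "openin (weak_topology scl T) V" "x \<in> V"
  obtains S e where "finite S" "S \<subseteq> topological_dual scl T" "e > (0::real)"
    "\<And>y. (\<And>f. f \<in> S \<Longrightarrow> norm (f y - f x) < e) \<Longrightarrow> y \<in> V"
proof -
  have "generate_topology_on {f -` U |f U. f \<in> topological_dual scl T \<and> open U} V"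
    using assms(1) by (simp add: weak_topology_def openin_topology_generated_by_iff)
  then have "x \<in> V \<Longrightarrow> \<exists>S e. finite S \<and> S \<subseteq> topological_dual scl T \<and> (e::real) > 0 \<and>
      (\<forall>y. (\<forall>f\<in>S. norm (f y - f x) < e) \<longrightarrow> y \<in> V)"
  proof induction
    case Empty
    then show ?case by simp
  next
    case (Int V W)
    then obtain S e S' e' where
      "finite S" "S \<subseteq> topological_dual scl T" "(e::real) > 0"
      "\<And>y. (\<forall>f\<in>S. norm (f y - f x) < e) \<Longrightarrow> y \<in> V"
      "finite S'" "S' \<subseteq> topological_dual scl T" "(e'::real) > 0"
      "\<And>y. (\<forall>f\<in>S'. norm (f y - f x) < e') \<Longrightarrow> y \<in> W"
      by auto
    then show ?case
      by (intro exI[of _ "S \<union> S'"] exI[of _ "min e e'"]) auto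
  next
    case (UN K)
    then obtain k where k: "k \<in> K" "x \<in> k" by blast
    with UN.IH[OF k] show ?case by blast
  next
    case (Basis V)
    then obtain f U where f: "V = f -` U" "f \<in> topological_dual scl T" "open U" by blast
    with \<open>x \<in> V\<close> obtain e where "e > 0" "ball (f x) e \<subseteq> U"
      by (auto simp: open_contains_ball)
    then show ?case
      using f by (intro exI[of _ "{f}"] exI[of _ e])
        (auto simp: dist_norm norm_minus_commute)
  qed
  with assms(2) obtain S e where "finite S" "S \<subseteq> topological_dual scl T" "(e::real) > 0"
    "\<forall>y. (\<forall>f\<in>S. norm (f y - f x) < e) \<longrightarrow> y \<in> V"
    by auto
  then show ?thesis by (intro that[of S e]) auto
qed

lemma weak_closure_imp_approximable:
  assumes x: "x \<in> weak_topology scl T closure_of A"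
    and S: "finite S" "S \<subseteq> topological_dual scl T" and e: "e > 0"
  obtains a where "a \<in> A" "\<And>f. f \<in> S \<Longrightarrow> norm (f a - f x) < e"
proof (cases "S = {}")
  case True
  have "A \<noteq> {}" using x by auto
  then show ?thesis using that True by blast
next
  case False
  let ?V = "\<Inter>f\<in>S. f -` ball (f x) e"
  have "openin (weak_topology scl T) ?V"
    using S False by (intro openin_INT2 openin_weak_topology_preimage) auto
  moreover have "x \<in> ?V" using e by simp
  ultimately obtain a where "a \<in> A" "a \<in> ?V"
    using x unfolding in_closure_of by blast
  then show ?thesis
    using that by (auto simp: dist_norm norm_minus_commute)
qed

lemma (in locally_convex_space) t1_space_weak_topology:
  assumes "Hausdorff_space T"
  shows "t1_space (weak_topology scl T)"
  unfolding t1_space_def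
proof (intro ballI impI)
  fix x y :: 'e assume "x \<noteq> y"
  then obtain f where f: "f \<in> topological_dual scl T" "f x \<noteq> f y"
    using dual_separates_points[OF assms] by blast
  then show "\<exists>U. openin (weak_topology scl T) U \<and> x \<in> U \<and> y \<notin> U"
    by (intro exI[of _ "f -` (- {f y})"] conjI openin_weak_topology_preimage) auto
qed

section \<open>Compactness of polars and finite approximations\<close>

definition polar ::
    "('k::{real_normed_field,euclidean_space} \<Rightarrow> 'e::ab_group_add \<Rightarrow> 'e) \<Rightarrow> 'e set
      \<Rightarrow> ('e \<Rightarrow> 'k) set" where
  "polar scl U = {f. Vector_Spaces.linear scl (*) f \<and> (\<forall>y\<in>U. norm (f y) \<le> 1)}"

text \<open>
  The \<open>n\<close>-tuples of functionals are the initial segments of sequences. A space of sequences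
  is a power with the fixed index type \<open>nat\<close>, so that the same product topology serves
  all \<open>n\<close>.
\<close>
definition approximates ::
    "('k::{real_normed_field,euclidean_space} \<Rightarrow> 'e::ab_group_add \<Rightarrow> 'e) \<Rightarrow> 'e set
      \<Rightarrow> nat \<Rightarrow> 'e \<Rightarrow> 'e set \<Rightarrow> bool" where
  "approximates scl U n x F \<longleftrightarrow>
     (\<forall>g :: nat \<Rightarrow> 'e \<Rightarrow> 'k. range g \<subseteq> polar scl U \<longrightarrow>
        (\<exists>a\<in>F. \<forall>i<n. norm (g i a - g i x) < 1 / Suc n))"

lemma polar_antimono: "U \<subseteq> V \<Longrightarrow> polar scl V \<subseteq> polar scl U"
  by (auto simp: polar_def)

context topological_vector_space
begin

lemma zero_in_polar: "(\<lambda>_. 0) \<in> polar scl U"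
  using vector_space_axioms by (simp add: polar_def Vector_Spaces.linear_iff vector_space_mult)

lemma polar_subset_dual:
  assumes "openin T U" "0 \<in> U"
  shows "polar scl U \<subseteq> topological_dual scl T"
  using bounded_on_neighbourhood_imp_dual[OF _ assms, of _ 1] by (auto simp: polar_def)

lemma dual_imp_in_polar:
  assumes f: "f \<in> topological_dual scl T"
    and base: "\<And>W. openin T W \<Longrightarrow> 0 \<in> W \<Longrightarrow> \<exists>n::nat. U n \<subseteq> W"
  obtains n where "f \<in> polar scl (U n)"
proof -
  have lin: "Vector_Spaces.linear scl (*) f" and cont: "continuous_map T euclidean f"
    using f by (auto simp: topological_dual_def)
  interpret f: Vector_Spaces.linear scl "(*)" f by (rule lin)
  have "openin T {y. f y \<in> ball 0 1}"
    using openin_continuous_map_preimage[OF cont, of "ball 0 1"] by (simp add: topspace_UNIV)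
  then obtain n where "U n \<subseteq> {y. f y \<in> ball 0 1}"
    using base[of "{y. f y \<in> ball 0 1}"] by auto
  then have "f \<in> polar scl (U n)"
    using lin by (auto simp: polar_def less_imp_le)
  then show ?thesis by (rule that)
qed

text \<open>
  Banach--Alaoglu: since \<open>U\<close> absorbs every \<open>y\<close>, the values at \<open>y\<close> of the functionals in the polar
  lie in a fixed ball, so the polar is contained in a product of compact balls; it is closed
  there, as linearity and the bound on \<open>U\<close> are closed conditions, each on finitely many values.
\<close>
lemma compact_polar:
  assumes "openin T U" "0 \<in> U"
  shows "compact (polar scl U)"
proof -
  have "\<exists>t>0. scl (of_real (1/t)) y \<in> U" for y
    using neighbourhood_absorbs[OF assms] by metis
  then obtain r :: "'e \<Rightarrow> real" where r: "\<And>y. r y > 0" "\<And>y. scl (of_real (1 / r y)) y \<in> U"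
    by metis
  let ?B = "Pi\<^sub>E UNIV (\<lambda>y. cball 0 (r y)) :: ('e \<Rightarrow> 'k) set"
  have "compactin (product_topology (\<lambda>_. euclidean) UNIV) ?B"
    by (simp add: compactin_PiE)
  then have "compact ?B"
    by (simp add: euclidean_product_topology)
  have eq: "polar scl U =
      {f. (\<forall>x y. f (x + y) = f x + f y) \<and> (\<forall>c x. f (scl c x) = c * f x) \<and>
          (\<forall>y. y \<in> U \<longrightarrow> norm (f y) \<le> 1)}"
    using vector_space_axioms by (auto simp: polar_def Vector_Spaces.linear_iff vector_space_mult)
  have "closed (polar scl U)"
    unfolding eq
    by (intro closed_Collect_conj closed_Collect_all closed_Collect_imp closed_Collect_eq
        closed_Collect_le continuous_intros continuous_on_product_coordinates open_Collect_const)
  moreover have "polar scl U \<subseteq> ?B"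
  proof (intro subsetI PiE_I)
    fix f y assume f: "f \<in> polar scl U"
    then interpret f: Vector_Spaces.linear scl "(*)" f by (simp add: polar_def)
    have "norm (f (scl (of_real (1 / r y)) y)) \<le> 1"
      using f r(2) by (auto simp: polar_def)
    then show "f y \<in> cball 0 (r y)"
      using r(1)[of y] by (simp add: f.scale norm_mult norm_divide field_simps)
  qed simp
  ultimately show ?thesis
    using \<open>compact ?B\<close> by (metis compact_Int_closed inf.absorb_iff2)
qed

text \<open>
  Each \<open>a \<in> A\<close> accounts for an open set of sequences of functionals, and these open sets cover
  the compact power of the polar because \<open>x\<close> is in the weak closure of \<open>A\<close>.
\<close>
lemma weak_closure_imp_finite_approximation:
  assumes U: "openin T U" "0 \<in> U" and x: "x \<in> weak_topology scl T closure_of A"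
  shows "\<exists>F. finite F \<and> F \<subseteq> A \<and> approximates scl U n x F"
proof -
  let ?G = "Pi\<^sub>E UNIV (\<lambda>_::nat. polar scl U)"
  let ?O = "\<lambda>a. \<Inter>i\<in>{..<n}. {g :: nat \<Rightarrow> 'e \<Rightarrow> 'k. norm (g i a - g i x) < 1 / Suc n}"
  have "compactin (product_topology (\<lambda>_. euclidean) UNIV) ?G"
    using compact_polar[OF U] by (simp add: compactin_PiE)
  then have "compact ?G"
    by (simp add: euclidean_product_topology)
  moreover have "open (?O a)" for a
  proof (intro open_INT ballI)
    have ev: "continuous_on UNIV (\<lambda>g :: nat \<Rightarrow> 'e \<Rightarrow> 'k. g i y)" for i y
      by (rule continuous_on_product_then_coordinatewise[OF continuous_on_product_coordinates])
    show "open {g :: nat \<Rightarrow> 'e \<Rightarrow> 'k. norm (g i a - g i x) < 1 / Suc n}" for i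
      by (intro open_Collect_less continuous_intros ev)
  qed simp
  moreover have "?G \<subseteq> (\<Union>a\<in>A. ?O a)"
  proof
    fix g assume g: "g \<in> ?G"
    then have "g ` {..<n} \<subseteq> topological_dual scl T"
      using polar_subset_dual[OF U] by auto
    then obtain a where "a \<in> A" "\<And>f. f \<in> g ` {..<n} \<Longrightarrow> norm (f a - f x) < 1 / Suc n"
      using weak_closure_imp_approximable[OF x, of "g ` {..<n}" "1 / Suc n"] by auto
    then show "g \<in> (\<Union>a\<in>A. ?O a)" by auto
  qed
  ultimately obtain F where F: "F \<subseteq> A" "finite F" "?G \<subseteq> (\<Union>a\<in>F. ?O a)"
    by (rule compactE_image)
  have "approximates scl U n x F"
    unfolding approximates_def
  proof (intro allI impI)
    fix g :: "nat \<Rightarrow> 'e \<Rightarrow> 'k" assume "range g \<subseteq> polar scl U"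
    then have "g \<in> ?G" by auto
    then have "g \<in> (\<Union>a\<in>F. ?O a)" using F(3) by blast
    then show "\<exists>a\<in>F. \<forall>i<n. norm (g i a - g i x) < 1 / Suc n" by auto
  qed
  then show ?thesis using F by blast
qed

lemma approximations_eventually_meet:
  assumes base: "\<And>W. openin T W \<Longrightarrow> 0 \<in> W \<Longrightarrow> \<exists>n. U n \<subseteq> W" and "decseq U"
    and F: "\<And>n. approximates scl (U n) n x (F n)"
    and V: "openin (weak_topology scl T) V" "x \<in> V"
  shows "\<exists>n0. \<forall>n\<ge>n0. F n \<inter> V \<noteq> {}"
proof -
  obtain S e where S: "finite S" "S \<subseteq> topological_dual scl T" "e > 0"
    and SV: "\<And>y. (\<And>f. f \<in> S \<Longrightarrow> norm (f y - f x) < e) \<Longrightarrow> y \<in> V"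
    using openin_weak_topology_imp_functionals[OF V] by metis
  have "\<exists>n. f \<in> polar scl (U n)" if "f \<in> S" for f
    using dual_imp_in_polar[OF _ base] S(2) that by (metis subsetD)
  then obtain k where k: "\<And>f. f \<in> S \<Longrightarrow> f \<in> polar scl (U (k f))" by metis
  obtain N where N: "1 / Suc N < e"
    by (rule nat_approx_posE[OF S(3)])
  obtain h where "bij_betw h {0..<card S} S"
    using ex_bij_betw_nat_finite[OF S(1)] by blast
  then have h: "S = h ` {0..<card S}"
    by (simp add: bij_betw_imp_surj_on)
  define n0 where "n0 = Max (insert N (insert (card S) (k ` S)))"
  have "F n \<inter> V \<noteq> {}" if "n0 \<le> n" for n
  proof -
    have le: "N \<le> n" "card S \<le> n" "\<And>f. f \<in> S \<Longrightarrow> k f \<le> n"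
      using that S(1) by (auto simp: n0_def)
    \<comment> \<open>An enumeration of \<open>S\<close>, continued by the zero functional, which lies in every polar.\<close>
    define g where "g i = (if i < card S then h i else (\<lambda>_. 0))" for i
    have "h i \<in> polar scl (U n)" if "i < card S" for i
    proof -
      have "h i \<in> S" by (subst h) (use that in simp)
      then show ?thesis
        using k le(3) polar_antimono[OF decseqD[OF \<open>decseq U\<close>]] by blast
    qed
    then have "range g \<subseteq> polar scl (U n)"
      using zero_in_polar by (auto simp: g_def)
    then obtain a where a: "a \<in> F n" "\<And>i. i < n \<Longrightarrow> norm (g i a - g i x) < 1 / Suc n"
      using F[of n] unfolding approximates_def by blast
    have "a \<in> V"
    proof (rule SV)
      fix f assume "f \<in> S"
      then obtain i where i: "i < card S" "f = h i" by (subst (asm) h) auto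
      have "norm (f a - f x) < 1 / Suc n"
        using a(2)[of i] i le(2) by (simp add: g_def)
      also have "\<dots> \<le> 1 / Suc N"
        using le(1) by (simp add: frac_le)
      finally show "norm (f a - f x) < e" using N by simp
    qed
    then show ?thesis using a(1) by blast
  qed
  then show ?thesis by blast
qed

section \<open>Fan tightness and the Reznichenko property\<close>

lemma countable_fan_tightness_weak_topology:
  assumes U: "\<And>n. openin T (U n)" "\<And>n. 0 \<in> U n" "decseq U"
    and base: "\<And>W. openin T W \<Longrightarrow> 0 \<in> W \<Longrightarrow> \<exists>n. U n \<subseteq> W"
  shows "countable_fan_tightness (weak_topology scl T)"
  unfolding countable_fan_tightness_def countable_fan_tightness_at_def
proof (intro ballI allI impI)
  fix x and A :: "nat \<Rightarrow> 'e set"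
  assume x: "x \<in> (\<Inter>n. weak_topology scl T closure_of A n)"
  have "\<exists>F. finite F \<and> F \<subseteq> A n \<and> approximates scl (U n) n x F" for n
    using x by (intro weak_closure_imp_finite_approximation[OF U(1,2)]) auto
  then obtain F where F: "\<And>n. finite (F n) \<and> F n \<subseteq> A n"
    and appr: "\<And>n. approximates scl (U n) n x (F n)"
    by metis
  have "x \<in> weak_topology scl T closure_of (\<Union>n. F n)"
    unfolding in_closure_of
  proof (intro conjI allI impI)
    show "x \<in> topspace (weak_topology scl T)"
      by (simp add: topspace_weak_topology vector_space_axioms)
    fix V assume V: "x \<in> V \<and> openin (weak_topology scl T) V"
    then have "\<exists>n0. \<forall>n\<ge>n0. F n \<inter> V \<noteq> {}"
      by (intro approximations_eventually_meet[OF base U(3) appr]) auto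
    then obtain n where "F n \<inter> V \<noteq> {}" by blast
    then show "\<exists>y. y \<in> (\<Union>n. F n) \<and> y \<in> V" by blast
  qed
  then show "\<exists>F. (\<forall>n. finite (F n) \<and> F n \<subseteq> A n) \<and> x \<in> weak_topology scl T closure_of (\<Union>n. F n)"
    using F by (intro exI[of _ F] conjI) auto
qed

lemma Reznichenko_property_weak_topology:
  assumes U: "\<And>n. openin T (U n)" "\<And>n. 0 \<in> U n" "decseq U"
    and base: "\<And>W. openin T W \<Longrightarrow> 0 \<in> W \<Longrightarrow> \<exists>n. U n \<subseteq> W"
    and t1: "t1_space (weak_topology scl T)"
  shows "Reznichenko_property (weak_topology scl T)"
  unfolding Reznichenko_property_def
proof (intro allI impI)
  let ?w = "weak_topology scl T"
  fix A x assume A: "A \<subseteq> topspace ?w" and x: "x \<in> ?w closure_of A - A"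
  have "\<exists>F. finite F \<and> F \<subseteq> A - G \<and> approximates scl (U n) n x F" if G: "finite G" "G \<subseteq> A"
    for n :: nat and G
  proof -
    have "?w closure_of G = G"
      using t1 G A by (meson closure_of_closedin order_trans t1_space_closedin_finite)
    moreover have "A = (A - G) \<union> G" using G by blast
    ultimately have "?w closure_of A = ?w closure_of (A - G) \<union> G"
      by (metis closure_of_Un)
    then have "x \<in> ?w closure_of (A - G)"
      using x G by blast
    then show ?thesis
      by (rule weak_closure_imp_finite_approximation[OF U(1,2)])
  qed
  note avoid = this
  define pick where "pick n G =
    (SOME F. finite F \<and> F \<subseteq> A - G \<and> approximates scl (U n) n x F)" for n G
  have pick: "finite (pick n G) \<and> pick n G \<subseteq> A - G \<and> approximates scl (U n) n x (pick n G)"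
    if "finite G" "G \<subseteq> A" for n G
    unfolding pick_def using avoid[OF that] by (rule someI_ex)
  \<comment> \<open>The recursion carries the union of all earlier choices, as the next one must avoid them all.\<close>
  define H where "H = rec_nat {} (\<lambda>n G. G \<union> pick n G)"
  have H_Suc: "H (Suc n) = H n \<union> pick n (H n)" for n by (simp add: H_def)
  have H: "finite (H n) \<and> H n \<subseteq> A" for n
  proof (induction n)
    case 0
    then show ?case by (simp add: H_def)
  next
    case (Suc n)
    then show ?case using pick[of "H n" n] by (auto simp: H_Suc)
  qed
  define F where "F n = pick n (H n)" for n
  have F: "finite (F n)" "F n \<subseteq> A - H n" "approximates scl (U n) n x (F n)" for n
    using pick[of "H n" n] H[of n] by (auto simp: F_def)
  have "F m \<inter> F n = {}" if "m < n" for m n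
  proof -
    have "mono H" by (rule incseq_SucI) (auto simp: H_Suc)
    then have "H (Suc m) \<subseteq> H n" using that by (simp add: monoD)
    moreover have "F m \<subseteq> H (Suc m)" by (simp add: F_def H_Suc)
    ultimately show ?thesis using F(2)[of n] by blast
  qed
  then have disj: "F m \<inter> F n = {}" if "m \<noteq> n" for m n
    using that by (metis Int_commute linorder_neqE_nat)
  \<comment> \<open>An approximating set contains a witness for every sequence in the polar, and there is one.\<close>
  have ne: "F n \<noteq> {}" for n
  proof -
    have "range (\<lambda>_::nat. \<lambda>_. 0) \<subseteq> polar scl (U n)" using zero_in_polar by auto
    then show ?thesis using F(3)[of n] unfolding approximates_def by blast
  qed
  have "inj F"
    using disj ne by (metis injI inf.idem)
  show "\<exists>\<N>. countable \<N> \<and> infinite \<N> \<and> pairwise disjnt \<N> \<and>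
      (\<forall>N\<in>\<N>. finite N \<and> N \<subseteq> A) \<and>
      (\<forall>W. W \<subseteq> topspace ?w \<longrightarrow> (\<exists>V. openin ?w V \<and> x \<in> V \<and> V \<subseteq> W) \<longrightarrow>
           finite {N \<in> \<N>. N \<inter> W = {}})"
  proof (intro exI[of _ "range F"] conjI allI impI)
    show "infinite (range F)"
      using \<open>inj F\<close> by (simp add: finite_image_iff)
    show "pairwise disjnt (range F)"
      by (intro pairwise_imageI) (auto simp: disjnt_def dest: disj)
    show "\<forall>N\<in>range F. finite N \<and> N \<subseteq> A"
      using F(1,2) by blast
    fix W assume "\<exists>V. openin ?w V \<and> x \<in> V \<and> V \<subseteq> W"
    then obtain V where V: "openin ?w V" "x \<in> V" "V \<subseteq> W" by blast
    have "\<exists>n0. \<forall>n\<ge>n0. F n \<inter> V \<noteq> {}"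
      by (rule approximations_eventually_meet[OF base U(3) F(3) V(1,2)])
    then obtain n0 where "\<And>n. n0 \<le> n \<Longrightarrow> F n \<inter> V \<noteq> {}" by blast
    then have "{N \<in> range F. N \<inter> W = {}} \<subseteq> F ` {..<n0}"
      using V(3) by (force simp: not_less[symmetric])
    then show "finite {N \<in> range F. N \<inter> W = {}}"
      by (rule finite_subset) simp
  qed simp
qed

end

lemma metrizable_imp_countable_neighbourhood_base:
  assumes "metrizable_space T" "x \<in> topspace T"
  obtains U :: "nat \<Rightarrow> 'a set" where "\<And>n. openin T (U n)" "\<And>n. x \<in> U n" "decseq U"
    "\<And>W. openin T W \<Longrightarrow> x \<in> W \<Longrightarrow> \<exists>n. U n \<subseteq> W"
proof -
  obtain M d where "Metric_space M d" and T: "T = Metric_space.mtopology M d"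
    using assms(1) by (auto simp: metrizable_space_def)
  then interpret Metric_space M d by simp
  have x: "x \<in> M" using assms(2) by (simp add: T)
  show ?thesis
  proof (rule that[of "\<lambda>n. mball x (1 / Suc n)"])
    show "decseq (\<lambda>n. mball x (1 / Suc n))"
      by (intro antimonoI mball_subset_concentric) (simp add: frac_le)
    show "\<exists>n. mball x (1 / Suc n) \<subseteq> W" if W: "openin T W" "x \<in> W" for W
    proof -
      obtain r where r: "r > 0" "mball x r \<subseteq> W"
        using W by (auto simp: T openin_mtopology)
      obtain n where "1 / Suc n < r"
        using nat_approx_posE[OF r(1)] by metis
      then show ?thesis
        using r(2) by (meson less_imp_le mball_subset_concentric order_trans)
    qed
  qed (use x in \<open>auto simp: T openin_mball\<close>)
qed

theorem theorem1p2:
  fixes scl :: "'k::{real_normed_field,euclidean_space} \<Rightarrow> 'e::ab_group_add \<Rightarrow> 'e"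
    and T :: "'e topology"
  assumes "locally_convex_space scl T"
    and "metrizable_space T"
  shows "countable_fan_tightness (weak_topology scl T)
       \<and> Reznichenko_property (weak_topology scl T)"
proof -
  interpret locally_convex_space scl T by fact
  obtain U :: "nat \<Rightarrow> 'e set" where U: "\<And>n. openin T (U n)" "\<And>n. 0 \<in> U n" "decseq U"
    "\<And>W. openin T W \<Longrightarrow> 0 \<in> W \<Longrightarrow> \<exists>n. U n \<subseteq> W"
    using metrizable_imp_countable_neighbourhood_base[OF assms(2), of 0]
    by (auto simp: topspace_UNIV)
  have "t1_space (weak_topology scl T)"
    using assms(2) by (intro t1_space_weak_topology metrizable_imp_Hausdorff_space)
  then show ?thesis
    using countable_fan_tightness_weak_topology[OF U] Reznichenko_property_weak_topology[OF U]
    by blast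
qed

end
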